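(* Let $f(x,y)=f_1x+f_2y$ and $g(x,y)=g_1x+g_2y$ be nonzero linear functions with $f_1,f_2,g_1,g_2\in\mathbb{Z}$, let $b$ be a positive integer, and let $S=\{v\in\mathbb{N}^2\mid f(v)\bmod b\le g(v)\}$ be nontrivial. Let $O=(0,0)$. (1) Suppose $g_1g_2\le 0$. Let $\mathfrak{u}$ be the generator of the monoid $\{v\in\mathbb{N}^2\mid g(v)=0,\ f(v)\bmod b=0\}$, and let $w$ be the point of intersection of $\{v\in\mathbb{R}_{\ge 0}^2\mid g(v)=b\}$ with the union of the two coordinate axes. Then $S$ has a unique minimal Frobenius vector, namely the minimal (for the product order) element among those integer points of $\mathrm{ConvexHull}(\{O,\mathfrak{u},w,w+\mathfrak{u}\})\setminus S$ that are closest to the line $\{v\in\mathbb{R}^2\mid g(v)=b\}$ (the set of integer points of $\mathrm{ConvexHull}(\{O,\mathfrak{u},w,w+\mathfrak{u}\})\setminus S$ being nonempty). (2) Suppose $g_1g_2>0$. Let $w_1$ and $w_2$ be the two points of intersection of $\{v\in\mathbb{R}^2\mid g(v)=b\}$ with the $x$-axis and the $y$-axis. Then every Frobenius vector of $S$ (in particular every minimal one) belongs to the finite set $(\mathrm{ConvexHull}(\{O,w_1,w_2\})\cap\mathbb{N}^2)\setminus S$.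
   Context: $\mathbb{N}$ is the set of non-negative integers; for an integer $a$ and a positive integer $b$, $a\bmod b\in\{0,\dots,b-1\}$ is the remainder of the Euclidean division of $a$ by $b$. The set $S$ is a submonoid of $\mathbb{N}^2$ (a proportionally modular semigroup). Nontrivial means that $S$ is not one of the degenerate cases: $g_1,g_2$ are not both $\le 0$. Hence in case (1) exactly one of $g_1,g_2$ is positive and $w$ is the single point $(b/g_1,0)$ or $(0,b/g_2)$ respectively; in case (2) $g_1,g_2>0$. When $g_1g_2\le0$ the monoid $\{v\in\mathbb{N}^2\mid g(v)=0,\ f(v)\bmod b=0\}$ is generated by a single nonzero element, denoted $\mathfrak{u}$. For $A\subset\mathbb{Q}^2$, $L(A)=\{\sum_{i=1}^m\lambda_ia_i\mid m\in\mathbb{N},\lambda_i\in\mathbb{Q}_{\ge0},a_i\in A\}$ is the rational cone of $A$, and $\mathrm{Tint}(L(A))$ is its topological interior. For an affine semigroup (finitely generated submonoid) $T\subseteq\mathbb{N}^2$, let $G(T)$ be the group generated by $T$. A Frobenius vector of $T$ is an element $q\in G(T)\cap\mathbb{N}^2$ with $q\notin T$ such that $(q+\mathrm{Tint}(L(T)))\cap G(T)\subset T\setminus\{0\}$. A Frobenius vector is minimal if it is minimal among the Frobenius vectors for the product order on $\mathbb{N}^2$ ($x\preceq y$ iff $y-x\in\mathbb{N}^2$).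
   Formalization: In part (1), nonemptiness of the set of integer points of ConvexHull({O,u,w,w+u})\S is assumed, not proved: it can fail, e.g. for f=(1,0), g=(1,0), b=1, where S=N^2 and there is no Frobenius vector. *)

theory Defs
  imports "HOL-Analysis.Analysis" "HOL-Computational_Algebra.Group_Closure"
begin

text \<open>
  Lattice points are elements of \<^typ>\<open>int \<times> int\<close>, and the plane is \<^typ>\<open>real \<times> real\<close>.
  On pairs, \<open>\<le>\<close> is the componentwise (product) order.
\<close>

definition emb :: "int \<times> int \<Rightarrow> real \<times> real" where
  "emb = map_prod of_int of_int"

definition nat_plane :: "(int \<times> int) set" where
  "nat_plane = {v. 0 \<le> fst v \<and> 0 \<le> snd v}"

text \<open>Used both at integer points and at real points.\<close>

definition lin_form :: "int \<Rightarrow> int \<Rightarrow> 'a::comm_ring_1 \<times> 'a \<Rightarrow> 'a" where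
  "lin_form a1 a2 v = of_int a1 * fst v + of_int a2 * snd v"

definition pm_semigroup :: "int \<Rightarrow> int \<Rightarrow> int \<Rightarrow> int \<Rightarrow> int \<Rightarrow> (int \<times> int) set" where
  "pm_semigroup f1 f2 g1 g2 b =
     {v \<in> nat_plane. lin_form f1 f2 v mod b \<le> lin_form g1 g2 v}"

definition is_monoid_generator :: "(int \<times> int) set \<Rightarrow> int \<times> int \<Rightarrow> bool" where
  "is_monoid_generator M u \<longleftrightarrow>
     u \<noteq> 0 \<and> M = {(int n * fst u, int n * snd u) | n. True}"

definition minimal_elements :: "'a::order set \<Rightarrow> 'a set" where
  "minimal_elements A = {a \<in> A. \<forall>x\<in>A. x \<le> a \<longrightarrow> x = a}"

definition rational_cone :: "(real \<times> real) set \<Rightarrow> (real \<times> real) set" where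
  "rational_cone A =
     {\<Sum>i<m. c i *\<^sub>R a i | (m::nat) c a. \<forall>i<m. c i \<in> \<rat> \<and> 0 \<le> c i \<and> a i \<in> A}"

text \<open>
  A rational cone consists of rational points, so it has empty interior in the real plane:
  the interior is the one in the subspace of rational points.
\<close>

definition Tint :: "(real \<times> real) set \<Rightarrow> (real \<times> real) set" where
  "Tint C = top_of_set (\<rat> \<times> \<rat>) interior_of C"

definition frobenius_vectors :: "(int \<times> int) set \<Rightarrow> (int \<times> int) set" where
  "frobenius_vectors T =
     {q \<in> group_closure T \<inter> nat_plane.
        q \<notin> T \<and>
        (\<lambda>t. emb q + t) ` Tint (rational_cone (emb ` T)) \<inter> emb ` group_closure T
          \<subseteq> emb ` (T - {0})}"

definition level_line :: "int \<Rightarrow> int \<Rightarrow> int \<Rightarrow> (real \<times> real) set" where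
  "level_line g1 g2 b = {v. lin_form g1 g2 v = of_int b}"

definition x_axis :: "(real \<times> real) set" where
  "x_axis = {v. snd v = 0}"

definition y_axis :: "(real \<times> real) set" where
  "y_axis = {v. fst v = 0}"

definition hull_gaps :: "(real \<times> real) set \<Rightarrow> (int \<times> int) set \<Rightarrow> (int \<times> int) set" where
  "hull_gaps V T = {v. emb v \<in> convex hull V} - T"

definition closest_to :: "(real \<times> real) set \<Rightarrow> (int \<times> int) set \<Rightarrow> (int \<times> int) set" where
  "closest_to L P = {v. is_arg_min (\<lambda>p. infdist (emb p) L) (\<lambda>p. p \<in> P) v}"

end

theory Submission
  imports Defs
begin

text \<open>
  Positive coefficients of \<open>g\<close> need only an estimate: a point of \<open>\<nat>\<^sup>2\<close> outside \<open>S\<close> satisfies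
  \<open>g < f mod b < b\<close>, so it lies in the triangle cut off by the line \<open>g = b\<close>, and every Frobenius
  vector is such a point.

  When the signs of \<open>g1\<close> and \<open>g2\<close> are opposite, or one of them vanishes, let \<open>h\<close> be the
  coordinate that vanishes on the axis containing \<open>w\<close>. The rational cone of \<open>S\<close> consists of the
  rational points with \<open>0 \<le> g\<close> and \<open>0 \<le> h\<close>, its interior is given by the strict inequalities
  (\<open>Tint_rational_cone_eq\<close>), and \<open>S\<close> generates the group of all lattice points. So a point
  \<open>q \<notin> S\<close> of \<open>\<nat>\<^sup>2\<close> is a Frobenius vector exactly when every lattice point at which both \<open>g\<close> and
  \<open>h\<close> are larger than at \<open>q\<close> is a nonzero element of \<open>S\<close> (\<open>frobenius_vectors_eq\<close>).

  Call the lattice points of the cone outside \<open>S\<close> gaps. A translation along \<open>u\<close> preserves \<open>g\<close> and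
  the residue of \<open>f\<close>, hence also being a gap as long as \<open>h\<close> stays nonnegative. All gaps have
  \<open>g < b\<close>, so there is a largest value of \<open>g\<close> on gaps. A gap on a higher level than \<open>q\<close> can be
  moved along \<open>u\<close> until it also has larger \<open>h\<close>, which prevents \<open>q\<close> from being a Frobenius vector;
  therefore the Frobenius vectors are precisely the gaps of largest \<open>g\<close>
  (\<open>frobenius_vectors_eq_top_gaps\<close>). They lie on one line, parallel to \<open>u\<close>, on which the product
  order is total, so there is a least one. The parallelogram of the statement is
  \<open>0 \<le> g \<le> b\<close>, \<open>0 \<le> h \<le> h u\<close>; translation by multiples of \<open>u\<close> brings every gap into it, and
  closeness to the line \<open>g = b\<close> means large \<open>g\<close>. So its gaps closest to the line are the Frobenius
  vectors with \<open>h \<le> h u\<close>, and the least Frobenius vector is among them.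
\<close>

section \<open>Linear forms and lattice points\<close>

lemma lin_form_add: "lin_form a1 a2 (v + w) = lin_form a1 a2 v + lin_form a1 a2 w"
  by (simp add: lin_form_def algebra_simps)

lemma lin_form_diff: "lin_form a1 a2 (v - w) = lin_form a1 a2 v - lin_form a1 a2 w"
  by (simp add: lin_form_def algebra_simps)

lemma lin_form_zero [simp]: "lin_form a1 a2 0 = 0"
  by (simp add: lin_form_def)

lemma lin_form_scaleR:
  fixes v :: "real \<times> real"
  shows "lin_form a1 a2 (r *\<^sub>R v) = r * lin_form a1 a2 v"
  by (simp add: lin_form_def algebra_simps)

lemma lin_form_sum: "lin_form a1 a2 (\<Sum>i\<in>I. v i) = (\<Sum>i\<in>I. lin_form a1 a2 (v i))"
  by (induction I rule: infinite_finite_induct) (simp_all add: lin_form_add)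

lemma lin_form_scale_int:
  "lin_form a1 a2 (k * fst v, k * snd v) = k * lin_form a1 a2 (v :: int \<times> int)"
  by (simp add: lin_form_def algebra_simps)

lemma lin_form_emb [simp]: "lin_form a1 a2 (emb v) = of_int (lin_form a1 a2 v)"
  by (simp add: lin_form_def emb_def)

lemma lin_form_eq_inner: "lin_form a1 a2 v = inner (of_int a1, of_int a2) (v :: real \<times> real)"
  by (simp add: lin_form_def inner_prod_def)

lemma continuous_on_lin_form: "continuous_on A (lin_form a1 a2 :: real \<times> real \<Rightarrow> real)"
  unfolding lin_form_def by (intro continuous_intros)

lemma emb_eq_iff [simp]: "emb v = emb w \<longleftrightarrow> v = w"
  by (simp add: emb_def prod_eq_iff)

lemma emb_diff: "emb (v - w) = emb v - emb w"
  by (simp add: emb_def prod_eq_iff)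

lemma emb_rational: "emb v \<in> \<rat> \<times> \<rat>"
  by (simp add: emb_def mem_Times_iff)

lemma lin_form_rational: "v \<in> \<rat> \<times> \<rat> \<Longrightarrow> lin_form a1 a2 v \<in> (\<rat> :: real set)"
  by (auto simp: lin_form_def)

section \<open>The rational cone of a set of lattice points\<close>

text \<open>
  The values of the two forms at \<open>a\<close> and \<open>c\<close> make a matrix with determinant different from \<open>0\<close>.
  It is the product of the coefficient matrix and the matrix with columns \<open>a\<close> and \<open>c\<close>, so the
  forms are linearly independent.
\<close>

lemma lin_forms_determine_point:
  fixes z :: "real \<times> real"
  assumes "lin_form p1 p2 a = (0::int)" "lin_form q1 q2 a > (0::int)"
    and "lin_form q1 q2 c = (0::int)" "lin_form p1 p2 c > (0::int)"
    and z: "lin_form p1 p2 z = 0" "lin_form q1 q2 z = 0"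
  shows "z = 0"
proof -
  define D where "D = p1 * q2 - p2 * q1"
  have "D * (fst a * snd c - snd a * fst c)
      = lin_form p1 p2 a * lin_form q1 q2 c - lin_form p1 p2 c * lin_form q1 q2 a"
    by (simp add: D_def lin_form_def algebra_simps)
  also have "\<dots> < 0" using assms by simp
  finally have D: "D \<noteq> 0" by auto
  have "of_int D * fst z = of_int q2 * lin_form p1 p2 z - of_int p2 * lin_form q1 q2 z"
    by (simp add: D_def lin_form_def algebra_simps)
  moreover have "of_int D * snd z = of_int p1 * lin_form q1 q2 z - of_int q1 * lin_form p1 p2 z"
    by (simp add: D_def lin_form_def algebra_simps)
  ultimately show ?thesis using D z by (simp add: prod_eq_iff)
qed

text \<open>
  The points \<open>a\<close> and \<open>c\<close> lie on the two edges of the cone bounded by the forms. The coordinates of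
  a rational point in the basis \<open>a\<close>, \<open>c\<close> are quotients of values of the forms, hence rational.
\<close>

lemma rational_cone_eq:
  assumes T: "T \<subseteq> {v. 0 \<le> lin_form p1 p2 v \<and> 0 \<le> lin_form q1 q2 v}"
    and a: "a \<in> T" "lin_form p1 p2 a = 0" "lin_form q1 q2 a > 0"
    and c: "c \<in> T" "lin_form q1 q2 c = 0" "lin_form p1 p2 c > 0"
  shows "rational_cone (emb ` T)
       = {v \<in> \<rat> \<times> \<rat>. 0 \<le> lin_form p1 p2 v \<and> 0 \<le> lin_form q1 q2 v}" (is "?L = ?R")
proof (intro equalityI subsetI)
  fix v assume "v \<in> ?L"
  then obtain m r d where v: "v = (\<Sum>i<m. r i *\<^sub>R d i)"
    and rd: "\<And>i. i < (m::nat) \<Longrightarrow> r i \<in> \<rat> \<and> 0 \<le> r i \<and> d i \<in> emb ` T"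
    by (auto simp: rational_cone_def)
  have "0 \<le> lin_form p1 p2 (d i) \<and> 0 \<le> lin_form q1 q2 (d i) \<and> d i \<in> \<rat> \<times> \<rat>"
    if i: "i < m" for i
  proof -
    from rd[OF i] obtain t where "t \<in> T" "d i = emb t" by auto
    then show ?thesis using T emb_rational[of t] by auto
  qed
  with rd show "v \<in> ?R"
    unfolding v
    by (auto simp: lin_form_sum lin_form_scaleR mem_Times_iff fst_sum snd_sum
        intro!: sum_nonneg Rats_sum Rats_mult)
next
  fix v assume v: "v \<in> ?R"
  define r where "r = lin_form q1 q2 v / of_int (lin_form q1 q2 a)"
  define s where "s = lin_form p1 p2 v / of_int (lin_form p1 p2 c)"
  have rs: "r \<in> \<rat>" "s \<in> \<rat>" "0 \<le> r" "0 \<le> s"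
    using v a c by (auto simp: r_def s_def intro!: Rats_divide lin_form_rational)
  have "v - (r *\<^sub>R emb a + s *\<^sub>R emb c) = 0"
    using a c
    by (intro lin_forms_determine_point[of p1 p2 a q1 q2 c])
       (simp_all add: lin_form_diff lin_form_add lin_form_scaleR r_def s_def)
  then have "v = (\<Sum>i<(2::nat). (if i = 0 then r else s) *\<^sub>R (if i = 0 then emb a else emb c))"
    by (simp add: numeral_2_eq_2)
  moreover have "\<forall>i<2. (if i = (0::nat) then r else s) \<in> \<rat> \<and> 0 \<le> (if i = 0 then r else s)
      \<and> (if i = 0 then emb a else emb c) \<in> emb ` T"
    using rs a c by auto
  ultimately show "v \<in> ?L"
    unfolding rational_cone_def
    by (intro CollectI exI[of _ "2::nat"] exI[of _ "\<lambda>i. if i = 0 then r else s"]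
        exI[of _ "\<lambda>i. if i = 0 then emb a else emb c"] conjI)
qed

lemma Tint_rational_cone_eq:
  assumes T: "T \<subseteq> {v. 0 \<le> lin_form p1 p2 v \<and> 0 \<le> lin_form q1 q2 v}"
    and a: "a \<in> T" "lin_form p1 p2 a = 0" "lin_form q1 q2 a > 0"
    and c: "c \<in> T" "lin_form q1 q2 c = 0" "lin_form p1 p2 c > 0"
  shows "Tint (rational_cone (emb ` T))
       = {v \<in> \<rat> \<times> \<rat>. 0 < lin_form p1 p2 v \<and> 0 < lin_form q1 q2 v}" (is "?L = ?R")
proof (intro equalityI subsetI)
  fix v assume "v \<in> ?L"
  then obtain U where U: "open U" "v \<in> U" "v \<in> \<rat> \<times> \<rat>"
    and sub: "(\<rat> \<times> \<rat>) \<inter> U \<subseteq> {v \<in> \<rat> \<times> \<rat>. 0 \<le> lin_form p1 p2 v \<and> 0 \<le> lin_form q1 q2 v}"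
    unfolding Tint_def interior_of_def rational_cone_eq[OF T a c] openin_open by blast
  \<comment> \<open>Both forms are positive at \<open>d\<close>, and \<open>v\<close> minus a small rational multiple of \<open>d\<close> is still in
    the cone, so both forms are positive at \<open>v\<close>.\<close>
  define d where "d = emb (a + c)"
  have "(\<lambda>n. v - inverse (real (Suc n)) *\<^sub>R d) \<longlonglongrightarrow> v - 0 *\<^sub>R d"
    by (intro tendsto_intros LIMSEQ_inverse_real_of_nat)
  then have "\<forall>\<^sub>F n in sequentially. v - inverse (real (Suc n)) *\<^sub>R d \<in> U"
    using U by (intro topological_tendstoD) auto
  then obtain n where n: "v - inverse (real (Suc n)) *\<^sub>R d \<in> U"
    by (auto simp: eventually_sequentially)
  define e where "e = inverse (real (Suc n))"
  have e: "e > 0" "e \<in> \<rat>" by (auto simp: e_def intro!: Rats_inverse)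
  have "v - e *\<^sub>R d \<in> \<rat> \<times> \<rat>"
    using U(3) e emb_rational[of "a + c"] by (auto simp: mem_Times_iff d_def)
  with n sub have "0 \<le> lin_form p1 p2 (v - e *\<^sub>R d)" "0 \<le> lin_form q1 q2 (v - e *\<^sub>R d)"
    by (auto simp: e_def)
  moreover have "0 < e * lin_form p1 p2 d" "0 < e * lin_form q1 q2 d"
    using e a c by (simp_all add: d_def lin_form_add)
  ultimately show "v \<in> ?R"
    using U(3) by (simp add: lin_form_diff lin_form_scaleR)
next
  fix v assume v: "v \<in> ?R"
  let ?U = "{v :: real \<times> real. 0 < lin_form p1 p2 v} \<inter> {v. 0 < lin_form q1 q2 v}"
  have "open ?U"
    by (intro open_Int open_Collect_less continuous_on_lin_form continuous_on_const)
  then have "openin (top_of_set (\<rat> \<times> \<rat>)) ((\<rat> \<times> \<rat>) \<inter> ?U)"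
    by (auto simp: openin_open)
  then show "v \<in> ?L"
    unfolding Tint_def interior_of_def rational_cone_eq[OF T a c]
    using v by (intro CollectI exI[of _ "(\<rat> \<times> \<rat>) \<inter> ?U"]) auto
qed

lemma frobenius_vectors_eq:
  assumes T: "T \<subseteq> {v. 0 \<le> lin_form p1 p2 v \<and> 0 \<le> lin_form q1 q2 v}"
    and a: "a \<in> T" "lin_form p1 p2 a = 0" "lin_form q1 q2 a > 0"
    and c: "c \<in> T" "lin_form q1 q2 c = 0" "lin_form p1 p2 c > 0"
    and G: "group_closure T = UNIV"
  shows "frobenius_vectors T = {q \<in> nat_plane - T.
           \<forall>v. lin_form p1 p2 q < lin_form p1 p2 v \<and> lin_form q1 q2 q < lin_form q1 q2 v
               \<longrightarrow> v \<in> T - {0}}"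
proof -
  have "(\<lambda>t. emb q + t) ` Tint (rational_cone (emb ` T)) \<inter> range emb
      = emb ` {v. lin_form p1 p2 q < lin_form p1 p2 v \<and> lin_form q1 q2 q < lin_form q1 q2 v}"
    (is "?A = emb ` ?B") for q
  proof (intro equalityI subsetI)
    fix x assume "x \<in> ?A"
    then obtain v t where x: "x = emb v" "x = emb q + t" and t: "t \<in> Tint (rational_cone (emb ` T))"
      by auto
    then have "t = emb (v - q)" by (simp add: emb_diff algebra_simps)
    with t have "v \<in> ?B"
      unfolding Tint_rational_cone_eq[OF T a c] by (simp add: lin_form_diff)
    with x show "x \<in> emb ` ?B" by blast
  next
    fix x assume "x \<in> emb ` ?B"
    then obtain v where x: "x = emb v" and v: "v \<in> ?B" by auto
    have "emb (v - q) \<in> Tint (rational_cone (emb ` T))"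
      unfolding Tint_rational_cone_eq[OF T a c]
      using v emb_rational[of "v - q"] by (auto simp: lin_form_diff)
    moreover have "x = emb q + emb (v - q)" by (simp add: x emb_diff)
    ultimately show "x \<in> ?A" using x by blast
  qed
  then show ?thesis
    unfolding frobenius_vectors_def G
    by (auto simp: image_subset_iff image_iff)
qed

section \<open>Distance to a hyperplane\<close>

lemma infdist_hyperplane:
  fixes n p :: "'a :: real_inner"
  assumes "n \<noteq> 0"
  shows "infdist p {v. inner n v = c} = \<bar>inner n p - c\<bar> / norm n"
proof (rule antisym)
  define foot where "foot = p - ((inner n p - c) / (norm n)\<^sup>2) *\<^sub>R n"
  have "inner n foot = c"
    using assms by (simp add: foot_def inner_diff_right power2_norm_eq_inner)
  then have foot: "foot \<in> {v. inner n v = c}" by simp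
  have "dist p foot = \<bar>inner n p - c\<bar> / norm n"
    using assms by (simp add: foot_def dist_norm power2_eq_square)
  with foot show "infdist p {v. inner n v = c} \<le> \<bar>inner n p - c\<bar> / norm n"
    using infdist_le by metis
  have "\<bar>inner n p - c\<bar> / norm n \<le> dist p v" if "inner n v = c" for v
  proof -
    have "\<bar>inner n p - c\<bar> = \<bar>inner n (p - v)\<bar>"
      using that by (simp add: inner_diff_right)
    also have "\<dots> \<le> norm n * dist p v"
      by (simp add: dist_norm Cauchy_Schwarz_ineq2)
    finally show ?thesis using assms by (simp add: divide_le_eq mult.commute)
  qed
  with foot show "\<bar>inner n p - c\<bar> / norm n \<le> infdist p {v. inner n v = c}"
    unfolding infdist_notempty[OF ex_in_conv[THEN iffD1, OF exI, OF foot]]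
    by (intro cINF_greatest) auto
qed

text \<open>On the side \<open>g \<le> b\<close> of the line \<open>g = b\<close>, comparing distances to it is comparing \<open>g\<close>.\<close>

lemma infdist_level_line_le_iff:
  assumes "(g1, g2) \<noteq> (0, 0)" "lin_form g1 g2 v \<le> b" "lin_form g1 g2 w \<le> b"
  shows "infdist (emb v) (level_line g1 g2 b) \<le> infdist (emb w) (level_line g1 g2 b)
     \<longleftrightarrow> lin_form g1 g2 w \<le> lin_form g1 g2 v"
proof -
  let ?n = "(of_int g1, of_int g2) :: real \<times> real"
  have n: "?n \<noteq> 0" using assms(1) by (simp add: zero_prod_def)
  have "infdist (emb z) (level_line g1 g2 b) = \<bar>of_int (lin_form g1 g2 z) - of_int b\<bar> / norm ?n" for z
    using infdist_hyperplane[OF n, of "emb z" "of_int b"]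
    by (simp add: level_line_def lin_form_eq_inner[symmetric])
  then show ?thesis
    using n assms(2,3) by (simp add: divide_le_cancel)
qed

section \<open>Minimal elements\<close>

lemma minimal_elements_of_least:
  assumes "q \<in> A" "\<And>x. x \<in> A \<Longrightarrow> q \<le> x"
  shows "minimal_elements A = {q}"
  using assms by (auto simp: minimal_elements_def dest: order.antisym)


section \<open>Forms with coefficients of opposite sign\<close>

text \<open>
  The form \<open>h\<close>, with coefficients \<open>h1\<close> and \<open>h2\<close>, is the coordinate that vanishes on the axis
  where \<open>g\<close> is positive. With it, the two possible sign patterns of \<open>g\<close> need no separate
  treatment: the real cone of \<open>S\<close> is \<open>0 \<le> g \<and> 0 \<le> h\<close>, the direction \<open>u\<close> spans its edge \<open>g = 0\<close>,
  and its other edge \<open>h = 0\<close> is that axis.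
\<close>

locale opposite_signs =
  fixes f1 f2 g1 g2 b h1 h2 :: int and S :: "(int \<times> int) set" and u :: "int \<times> int"
  assumes b_pos: "0 < b"
    and signs: "0 < g1 \<and> g2 \<le> 0 \<and> h1 = 0 \<and> h2 = 1 \<or> g1 \<le> 0 \<and> 0 < g2 \<and> h1 = 1 \<and> h2 = 0"
    and S_eq: "S = pm_semigroup f1 f2 g1 g2 b"
    and u_generator: "is_monoid_generator
          {v \<in> nat_plane. lin_form g1 g2 v = 0 \<and> lin_form f1 f2 v mod b = 0} u"
begin

lemma nat_plane_h_nonneg: "v \<in> nat_plane \<Longrightarrow> 0 \<le> lin_form h1 h2 v"
  using signs by (auto simp: nat_plane_def lin_form_def)

lemma cone_in_nat_plane:
  assumes "0 \<le> lin_form g1 g2 v" "0 \<le> lin_form h1 h2 v"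
  shows "v \<in> nat_plane"
  using signs
proof (elim disjE conjE)
  assume s: "0 < g1" "g2 \<le> 0" "h1 = 0" "h2 = 1"
  with assms have "g2 * snd v \<le> 0" by (simp add: lin_form_def mult_nonpos_nonneg)
  with assms have "0 \<le> g1 * fst v" by (simp add: lin_form_def)
  with s assms show ?thesis by (simp add: nat_plane_def lin_form_def zero_le_mult_iff)
next
  assume s: "g1 \<le> 0" "0 < g2" "h1 = 1" "h2 = 0"
  with assms have "g1 * fst v \<le> 0" by (simp add: lin_form_def mult_nonpos_nonneg)
  with assms have "0 \<le> g2 * snd v" by (simp add: lin_form_def)
  with s assms show ?thesis by (simp add: nat_plane_def lin_form_def zero_le_mult_iff)
qed

lemma mem_S_iff: "v \<in> S \<longleftrightarrow> 0 \<le> lin_form h1 h2 v \<and> lin_form f1 f2 v mod b \<le> lin_form g1 g2 v"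
  using nat_plane_h_nonneg[of v] cone_in_nat_plane[of v] pos_mod_sign[OF b_pos, of "lin_form f1 f2 v"]
  by (auto simp: S_eq pm_semigroup_def)

lemma S_in_cone: "v \<in> S \<Longrightarrow> 0 \<le> lin_form g1 g2 v \<and> 0 \<le> lin_form h1 h2 v"
  using pos_mod_sign[OF b_pos, of "lin_form f1 f2 v"] by (auto simp: mem_S_iff)

lemma high_mem_S: "0 \<le> lin_form h1 h2 v \<Longrightarrow> b \<le> lin_form g1 g2 v \<Longrightarrow> v \<in> S"
  using pos_mod_bound[OF b_pos, of "lin_form f1 f2 v"] by (auto simp: mem_S_iff)

lemma
  shows g_u: "lin_form g1 g2 u = 0"
    and f_u: "b dvd lin_form f1 f2 u"
    and h_u: "0 < lin_form h1 h2 u"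
    and u_mem_S: "u \<in> S"
proof -
  have "u = (int 1 * fst u, int 1 * snd u)" by simp
  then have u: "u \<in> {v \<in> nat_plane. lin_form g1 g2 v = 0 \<and> lin_form f1 f2 v mod b = 0}"
    using u_generator unfolding is_monoid_generator_def by blast
  then show g: "lin_form g1 g2 u = 0" and "b dvd lin_form f1 f2 u" by auto
  have "lin_form h1 h2 u \<noteq> 0"
  proof
    assume "lin_form h1 h2 u = 0"
    with g signs have "u = 0" by (auto simp: lin_form_def prod_eq_iff)
    then show False using u_generator by (simp add: is_monoid_generator_def)
  qed
  with u nat_plane_h_nonneg[of u] show h: "0 < lin_form h1 h2 u" by simp
  with u show "u \<in> S" by (simp add: mem_S_iff)
qed

definition axis_point :: "int \<times> int" where
  "axis_point = (b * h2, b * h1)"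

lemma
  shows h_axis_point: "lin_form h1 h2 axis_point = 0"
    and g_axis_point: "b \<le> lin_form g1 g2 axis_point"
    and axis_point_mem_S: "axis_point \<in> S"
proof -
  show h: "lin_form h1 h2 axis_point = 0"
    using signs by (auto simp: axis_point_def lin_form_def)
  have "lin_form g1 g2 axis_point = (if h2 = 1 then g1 else g2) * b"
    using signs by (auto simp: axis_point_def lin_form_def)
  moreover have "1 \<le> (if h2 = 1 then g1 else g2)" using signs by auto
  ultimately show g: "b \<le> lin_form g1 g2 axis_point"
    using b_pos mult_right_mono[of 1 "if h2 = 1 then g1 else g2" b] by simp
  show "axis_point \<in> S" using high_mem_S h g by simp
qed

definition translate :: "int \<Rightarrow> int \<times> int \<Rightarrow> int \<times> int" where
  "translate n v = v + (n * fst u, n * snd u)"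

lemma g_translate: "lin_form g1 g2 (translate n v) = lin_form g1 g2 v"
  by (simp add: translate_def lin_form_add lin_form_scale_int g_u)

lemma h_translate: "lin_form h1 h2 (translate n v) = lin_form h1 h2 v + n * lin_form h1 h2 u"
  by (simp add: translate_def lin_form_add lin_form_scale_int)

text \<open>Neither \<open>g\<close> nor the residue of \<open>f\<close> modulo \<open>b\<close> changes along \<open>u\<close>.\<close>

lemma translate_mem_S_iff:
  assumes "0 \<le> lin_form h1 h2 v" "0 \<le> lin_form h1 h2 (translate n v)"
  shows "translate n v \<in> S \<longleftrightarrow> v \<in> S"
proof -
  obtain k where "lin_form f1 f2 u = b * k" using f_u by (auto elim: dvdE)
  then have "lin_form f1 f2 (translate n v) = lin_form f1 f2 v + b * (n * k)"
    by (simp add: translate_def lin_form_add lin_form_scale_int algebra_simps)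
  then have "lin_form f1 f2 (translate n v) mod b = lin_form f1 f2 v mod b" by simp
  with assms show ?thesis by (simp add: mem_S_iff g_translate)
qed

text \<open>
  Adding a large multiple of \<open>axis_point + u\<close> moves any lattice point into the part of the cone
  where \<open>b \<le> g\<close>, which lies in \<open>S\<close>.
\<close>

lemma group_closure_S: "group_closure S = UNIV"
proof -
  have "v \<in> group_closure S" for v
  proof -
    define n where "n = b + \<bar>lin_form g1 g2 v\<bar> + \<bar>lin_form h1 h2 v\<bar>"
    define t where "t = (n * fst (axis_point + u), n * snd (axis_point + u))"
    have n: "1 \<le> n" using b_pos by (simp add: n_def)
    have gt: "lin_form g1 g2 t = n * lin_form g1 g2 axis_point"
      and ht: "lin_form h1 h2 t = n * lin_form h1 h2 u"
      unfolding t_def lin_form_scale_int by (simp_all add: lin_form_add g_u h_axis_point)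
    have "n \<le> lin_form g1 g2 t" "n \<le> lin_form h1 h2 t"
      unfolding gt ht
      using n b_pos g_axis_point h_u by (auto simp: mult_le_cancel_left1)
    moreover have "b \<le> n" by (simp add: n_def)
    ultimately have "v + t \<in> S" "t \<in> S"
      using n b_pos by (auto intro!: high_mem_S simp: lin_form_add n_def)
    then have "(v + t) - t \<in> group_closure S"
      by (intro group_closure.diff group_closure.base) auto
    then show ?thesis by simp
  qed
  then show ?thesis by blast
qed

definition gaps :: "(int \<times> int) set" where
  "gaps = {v. 0 \<le> lin_form g1 g2 v \<and> 0 \<le> lin_form h1 h2 v} - S"

definition top_gaps :: "(int \<times> int) set" where
  "top_gaps = {v \<in> gaps. \<forall>w\<in>gaps. lin_form g1 g2 w \<le> lin_form g1 g2 v}"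

lemma gap_below_line: "v \<in> gaps \<Longrightarrow> lin_form g1 g2 v < b"
  using high_mem_S[of v] by (force simp: gaps_def)

lemma translate_gap: "v \<in> gaps \<Longrightarrow> 0 \<le> lin_form h1 h2 (translate n v) \<Longrightarrow> translate n v \<in> gaps"
  using translate_mem_S_iff[of v n] by (auto simp: gaps_def g_translate)

text \<open>
  Above any candidate \<open>q\<close> there must be no gap. Since a gap can be moved along \<open>u\<close> to make \<open>h\<close>
  arbitrarily large, only the level of \<open>g\<close> decides whether a gap lies above \<open>q\<close>.
  That some gap exists excludes Frobenius vectors with \<open>g < 0\<close>.
\<close>

lemma frobenius_vectors_eq_top_gaps:
  assumes "gaps \<noteq> {}"
  shows "frobenius_vectors S = top_gaps"
proof -
  have F: "frobenius_vectors S = {q \<in> nat_plane - S.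
           \<forall>v. lin_form g1 g2 q < lin_form g1 g2 v \<and> lin_form h1 h2 q < lin_form h1 h2 v
               \<longrightarrow> v \<in> S - {0}}"
    using b_pos g_axis_point
    by (intro frobenius_vectors_eq[where a = u and c = axis_point])
       (auto dest: S_in_cone simp: u_mem_S g_u h_u axis_point_mem_S h_axis_point group_closure_S)
  show ?thesis
  proof (intro equalityI subsetI)
    fix q assume "q \<in> frobenius_vectors S"
    then have q: "q \<in> nat_plane" "q \<notin> S"
      and above: "\<And>v. lin_form g1 g2 q < lin_form g1 g2 v \<Longrightarrow> lin_form h1 h2 q < lin_form h1 h2 v
                     \<Longrightarrow> v \<in> S"
      by (auto simp: F)
    have hq: "0 \<le> lin_form h1 h2 q" using nat_plane_h_nonneg q by simp
    have le: "lin_form g1 g2 v \<le> lin_form g1 g2 q" if v: "v \<in> gaps" for v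
    proof (rule ccontr)
      assume less: "\<not> ?thesis"
      \<comment> \<open>Since \<open>1 \<le> h u\<close>, this many translations along \<open>u\<close> lift \<open>v\<close> above \<open>h q\<close>.\<close>
      let ?n = "lin_form h1 h2 q + 1"
      have "?n \<le> ?n * lin_form h1 h2 u"
        using hq h_u by (simp add: mult_le_cancel_left1)
      moreover have "0 \<le> lin_form h1 h2 v" using v by (simp add: gaps_def)
      ultimately have h: "lin_form h1 h2 q < lin_form h1 h2 (translate ?n v)"
        by (simp add: h_translate)
      with less above[of "translate ?n v"] have "translate ?n v \<in> S"
        by (simp add: g_translate)
      moreover have "translate ?n v \<in> gaps" using translate_gap[OF v] h hq by simp
      ultimately show False by (simp add: gaps_def)
    qed
    from assms obtain v where "v \<in> gaps" by blast
    with le[of v] have "0 \<le> lin_form g1 g2 q" by (simp add: gaps_def)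
    with q hq le show "q \<in> top_gaps" by (simp add: top_gaps_def gaps_def)
  next
    fix q assume q: "q \<in> top_gaps"
    then have g: "q \<notin> S" "0 \<le> lin_form g1 g2 q" "0 \<le> lin_form h1 h2 q"
      by (auto simp: top_gaps_def gaps_def)
    have "v \<in> S - {0}"
      if v: "lin_form g1 g2 q < lin_form g1 g2 v" "lin_form h1 h2 q < lin_form h1 h2 v" for v
    proof -
      have "v \<notin> gaps" using q v(1) by (auto simp: top_gaps_def)
      with v g have "v \<in> S" by (simp add: gaps_def)
      moreover have "v \<noteq> 0" using v(1) g by auto
      ultimately show ?thesis by simp
    qed
    with g cone_in_nat_plane show "q \<in> frobenius_vectors S" by (simp add: F)
  qed
qed

lemma top_gaps_nonempty:
  assumes "gaps \<noteq> {}"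
  shows "top_gaps \<noteq> {}"
proof -
  from assms obtain k where "k \<in> gaps" by blast
  from ex_has_least_nat[of "\<lambda>v. v \<in> gaps", OF this, of "\<lambda>v. nat (b - lin_form g1 g2 v)"]
  obtain q where q: "q \<in> gaps"
    and least: "\<And>v. v \<in> gaps \<Longrightarrow> nat (b - lin_form g1 g2 q) \<le> nat (b - lin_form g1 g2 v)"
    by blast
  have "lin_form g1 g2 v \<le> lin_form g1 g2 q" if "v \<in> gaps" for v
    using least[OF that] gap_below_line[OF that] by simp
  with q show ?thesis unfolding top_gaps_def by blast
qed

lemma le_on_level:
  fixes v w :: "int \<times> int"
  assumes g: "lin_form g1 g2 v = lin_form g1 g2 w" and h: "lin_form h1 h2 v \<le> lin_form h1 h2 w"
  shows "v \<le> w"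
proof -
  have "w - v \<in> nat_plane"
    using g h by (intro cone_in_nat_plane) (simp_all add: lin_form_diff)
  then show ?thesis by (simp add: nat_plane_def less_eq_prod_def)
qed

text \<open>All top gaps lie on one level of \<open>g\<close>, on which the product order is the order by \<open>h\<close>.\<close>

lemma least_top_gap_exists:
  assumes "gaps \<noteq> {}"
  obtains q where "q \<in> top_gaps" "\<And>v. v \<in> top_gaps \<Longrightarrow> q \<le> v"
proof -
  from top_gaps_nonempty[OF assms] obtain k where "k \<in> top_gaps" by blast
  from ex_has_least_nat[of "\<lambda>v. v \<in> top_gaps", OF this, of "\<lambda>v. nat (lin_form h1 h2 v)"]
  obtain q where q: "q \<in> top_gaps"
    and least: "\<And>v. v \<in> top_gaps \<Longrightarrow> nat (lin_form h1 h2 q) \<le> nat (lin_form h1 h2 v)"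
    by blast
  have "q \<le> v" if v: "v \<in> top_gaps" for v
  proof (rule le_on_level)
    show "lin_form g1 g2 q = lin_form g1 g2 v"
      using q v by (intro antisym) (auto simp: top_gaps_def)
    show "lin_form h1 h2 q \<le> lin_form h1 h2 v"
      using least[OF v] q v by (auto simp: top_gaps_def gaps_def)
  qed
  with q that show ?thesis by blast
qed

text \<open>The remainder of \<open>h v\<close> modulo \<open>h u\<close> is the value of \<open>h\<close> at a translate of \<open>v\<close>.\<close>

lemma gap_translate_into_strip:
  assumes v: "v \<in> gaps"
  obtains v' where "v' \<in> gaps" "lin_form g1 g2 v' = lin_form g1 g2 v"
    "lin_form h1 h2 v' \<le> lin_form h1 h2 u" "v' \<le> v"
proof
  define v' where "v' = translate (- (lin_form h1 h2 v div lin_form h1 h2 u)) v"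
  have h: "lin_form h1 h2 v' = lin_form h1 h2 v mod lin_form h1 h2 u"
    by (simp add: v'_def h_translate minus_div_mult_eq_mod)
  then have bounds: "0 \<le> lin_form h1 h2 v'" "lin_form h1 h2 v' < lin_form h1 h2 u"
    using h_u by simp_all
  then show "v' \<in> gaps" "lin_form g1 g2 v' = lin_form g1 g2 v"
    "lin_form h1 h2 v' \<le> lin_form h1 h2 u"
    using v translate_gap by (simp_all add: v'_def g_translate)
  have "0 \<le> lin_form h1 h2 v" using v by (simp add: gaps_def)
  then show "v' \<le> v"
    using h_u by (intro le_on_level) (simp_all add: h zmod_le_nonneg_dividend, simp add: v'_def g_translate)
qed

text \<open>
  The parallelogram is the product of the intervals \<open>[0, b]\<close> and \<open>[0, h u]\<close> in the coordinates
  \<open>(g, h)\<close>.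
\<close>

lemma convex_hull_parallelogram:
  assumes w: "lin_form g1 g2 w = of_int b" "lin_form h1 h2 w = 0"
  shows "convex hull {0, emb u, w, w + emb u} =
      {v. 0 \<le> lin_form g1 g2 v \<and> lin_form g1 g2 v \<le> of_int b
        \<and> 0 \<le> lin_form h1 h2 v \<and> lin_form h1 h2 v \<le> of_int (lin_form h1 h2 u)}"
    (is "?H = ?P")
proof (rule equalityI)
  have "?P = {v. inner (of_int g1, of_int g2) v \<ge> 0} \<inter> {v. inner (of_int g1, of_int g2) v \<le> of_int b}
      \<inter> {v. inner (of_int h1, of_int h2) v \<ge> 0}
      \<inter> {v. inner (of_int h1, of_int h2) v \<le> of_int (lin_form h1 h2 u)}"
    by (auto simp: lin_form_eq_inner)
  then have "convex ?P"
    by (simp only:) (intro convex_Int convex_halfspace_ge convex_halfspace_le)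
  then show "?H \<subseteq> ?P"
    using w g_u h_u b_pos
    by (intro hull_minimal) (auto simp: lin_form_add)
  show "?P \<subseteq> ?H"
  proof
    fix v assume v: "v \<in> ?P"
    \<comment> \<open>\<open>s\<close> and \<open>t\<close> are the coordinates of \<open>v\<close> in the basis \<open>u\<close>, \<open>w\<close>.\<close>
    define s where "s = lin_form h1 h2 v / of_int (lin_form h1 h2 u)"
    define t where "t = lin_form g1 g2 v / of_int b"
    have st: "0 \<le> s" "s \<le> 1" "0 \<le> t" "t \<le> 1"
      using v h_u b_pos by (auto simp: s_def t_def divide_le_eq_1)
    have "v - (s *\<^sub>R emb u + t *\<^sub>R w) = 0"
    proof (rule lin_forms_determine_point[of g1 g2 u h1 h2 axis_point])
      show "0 < lin_form g1 g2 axis_point" using b_pos g_axis_point by simp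
      show "lin_form g1 g2 (v - (s *\<^sub>R emb u + t *\<^sub>R w)) = 0"
        using b_pos by (simp add: lin_form_diff lin_form_add lin_form_scaleR g_u w t_def)
      show "lin_form h1 h2 (v - (s *\<^sub>R emb u + t *\<^sub>R w)) = 0"
        using h_u by (simp add: lin_form_diff lin_form_add lin_form_scaleR w s_def)
    qed (use g_u h_u h_axis_point in simp_all)
    then have "v = (1 - t) *\<^sub>R ((1 - s) *\<^sub>R 0 + s *\<^sub>R emb u)
                 + t *\<^sub>R ((1 - s) *\<^sub>R w + s *\<^sub>R (w + emb u))"
      by (simp add: algebra_simps)
    moreover have "\<dots> \<in> ?H"
      using st by (intro convexD_alt convex_convex_hull hull_inc) simp_all
    ultimately show "v \<in> ?H" by metis
  qed
qed

lemma hull_gaps_parallelogram: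
  assumes w: "lin_form g1 g2 w = of_int b" "lin_form h1 h2 w = 0"
  shows "hull_gaps {0, emb u, w, w + emb u} S = {v \<in> gaps. lin_form h1 h2 v \<le> lin_form h1 h2 u}"
  unfolding hull_gaps_def convex_hull_parallelogram[OF w]
  using gap_below_line by (force simp: gaps_def)

text \<open>
  Every level of \<open>g\<close> that contains a gap contains one in the strip \<open>h \<le> h u\<close>. So being highest among
  the gaps of the strip is the same as being highest among all gaps.
\<close>

lemma closest_gaps:
  assumes w: "lin_form g1 g2 w = of_int b" "lin_form h1 h2 w = 0"
  shows "closest_to (level_line g1 g2 b) (hull_gaps {0, emb u, w, w + emb u} S)
       = {v \<in> top_gaps. lin_form h1 h2 v \<le> lin_form h1 h2 u}"
proof -
  define P where "P = {v \<in> gaps. lin_form h1 h2 v \<le> lin_form h1 h2 u}"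
  have nz: "(g1, g2) \<noteq> (0, 0)" using signs by auto
  have "closest_to (level_line g1 g2 b) P
      = {v \<in> P. \<forall>x\<in>P. infdist (emb v) (level_line g1 g2 b) \<le> infdist (emb x) (level_line g1 g2 b)}"
    by (auto simp: closest_to_def is_arg_min_linorder)
  also have "\<dots> = {v \<in> P. \<forall>x\<in>P. lin_form g1 g2 x \<le> lin_form g1 g2 v}"
  proof -
    have "lin_form g1 g2 v \<le> b" if "v \<in> P" for v
      using that gap_below_line[of v] by (simp add: P_def)
    then show ?thesis
      using infdist_level_line_le_iff[OF nz] by blast
  qed
  also have "\<dots> = {v \<in> P. \<forall>x\<in>gaps. lin_form g1 g2 x \<le> lin_form g1 g2 v}"
  proof -
    have "\<exists>x'\<in>P. lin_form g1 g2 x' = lin_form g1 g2 x" if "x \<in> gaps" for x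
      using gap_translate_into_strip[OF that] by (metis (no_types, lifting) P_def mem_Collect_eq)
    then show ?thesis by (force simp: P_def)
  qed
  also have "\<dots> = {v \<in> top_gaps. lin_form h1 h2 v \<le> lin_form h1 h2 u}"
    by (auto simp: P_def top_gaps_def)
  finally show ?thesis
    by (simp add: hull_gaps_parallelogram[OF w] P_def)
qed

theorem minimal_frobenius_vector:
  assumes w: "lin_form g1 g2 w = of_int b" "lin_form h1 h2 w = 0"
    and nonempty: "hull_gaps {0, emb u, w, w + emb u} S \<noteq> {}"
  shows "\<exists>q. minimal_elements (frobenius_vectors S) = {q}
    \<and> minimal_elements (closest_to (level_line g1 g2 b) (hull_gaps {0, emb u, w, w + emb u} S)) = {q}"
proof -
  have gaps: "gaps \<noteq> {}" using nonempty by (auto simp: hull_gaps_parallelogram[OF w])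
  then obtain q where q: "q \<in> top_gaps" and least: "\<And>v. v \<in> top_gaps \<Longrightarrow> q \<le> v"
    by (rule least_top_gap_exists) blast
  have "q \<in> gaps" using q by (simp add: top_gaps_def)
  then obtain q' where q': "q' \<in> gaps" "lin_form g1 g2 q' = lin_form g1 g2 q"
    "lin_form h1 h2 q' \<le> lin_form h1 h2 u" "q' \<le> q"
    by (rule gap_translate_into_strip)
  then have "q' \<in> top_gaps" using q by (simp add: top_gaps_def)
  then have "q' = q" by (intro order.antisym q'(4) least)
  with q'(3) have strip: "lin_form h1 h2 q \<le> lin_form h1 h2 u" by simp
  have "minimal_elements (frobenius_vectors S) = {q}"
    unfolding frobenius_vectors_eq_top_gaps[OF gaps]
    by (intro minimal_elements_of_least q least)
  moreover have "minimal_elements {v \<in> top_gaps. lin_form h1 h2 v \<le> lin_form h1 h2 u} = {q}"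
    using q strip least by (intro minimal_elements_of_least) simp_all
  ultimately show ?thesis by (auto simp: closest_gaps[OF w])
qed

end

section \<open>Forms with positive coefficients\<close>

lemma lattice_triangle_finite:
  assumes "0 < g1" "0 < g2"
  shows "finite {v \<in> nat_plane. lin_form g1 g2 v \<le> b}"
proof (rule finite_subset)
  show "{v \<in> nat_plane. lin_form g1 g2 v \<le> b} \<subseteq> {0..b} \<times> {0..b}"
  proof
    fix v assume v: "v \<in> {v \<in> nat_plane. lin_form g1 g2 v \<le> b}"
    then have "fst v \<le> g1 * fst v" "snd v \<le> g2 * snd v" "0 \<le> fst v" "0 \<le> snd v"
      using assms by (auto simp: nat_plane_def mult_le_cancel_right1)
    with v show "v \<in> {0..b} \<times> {0..b}" by (auto simp: lin_form_def mem_Times_iff)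
  qed
qed simp

lemma lin_form_le_on_triangle:
  assumes "0 < b"
    and w: "lin_form g1 g2 w1 = of_int b" "lin_form g1 g2 w2 = of_int b"
    and v: "v \<in> convex hull {0, w1, w2}"
  shows "lin_form g1 g2 v \<le> (of_int b :: real)"
proof -
  have "convex hull {0, w1, w2} \<subseteq> {v. inner (of_int g1, of_int g2) v \<le> of_int b}"
    using assms by (intro hull_minimal convex_halfspace_le) (auto simp flip: lin_form_eq_inner)
  with v show ?thesis by (auto simp: lin_form_eq_inner)
qed

lemma lattice_point_in_triangle:
  assumes pos: "0 < g1" "0 < g2" "0 < b"
    and w1: "lin_form g1 g2 w1 = of_int b" "snd w1 = 0"
    and w2: "lin_form g1 g2 w2 = of_int b" "fst w2 = 0"
    and v: "v \<in> nat_plane" "lin_form g1 g2 v \<le> b"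
  shows "emb v \<in> convex hull {0, w1, w2}"
proof -
  \<comment> \<open>The coordinates of \<open>v\<close> in the basis \<open>w1\<close>, \<open>w2\<close>; their sum is \<open>g v / b\<close>.\<close>
  define s where "s = of_int (g1 * fst v) / (of_int b :: real)"
  define t where "t = of_int (g2 * snd v) / (of_int b :: real)"
  have "0 \<le> s" "0 \<le> t" using pos v by (auto simp: s_def t_def nat_plane_def)
  moreover have "s + t \<le> 1"
  proof -
    have "s + t = of_int (lin_form g1 g2 v) / of_int b"
      by (simp add: s_def t_def lin_form_def add_divide_distrib)
    also have "\<dots> \<le> 1" using v pos by simp
    finally show ?thesis .
  qed
  moreover have "emb v = (1 - s - t) *\<^sub>R 0 + s *\<^sub>R w1 + t *\<^sub>R w2"
  proof -
    have "fst w1 = of_int b / of_int g1" "snd w2 = of_int b / of_int g2"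
      using pos w1 w2 by (auto simp: lin_form_def field_simps)
    with pos w1 w2 show ?thesis by (simp add: prod_eq_iff emb_def s_def t_def)
  qed
  ultimately show ?thesis
    unfolding convex_hull_3
    by (intro CollectI exI[of _ "1 - s - t"] exI[of _ s] exI[of _ t]) simp
qed

theorem proposition9:
  fixes f1 f2 g1 g2 b :: int
    and S :: "(int \<times> int) set"
  assumes f_nonzero: "(f1, f2) \<noteq> (0, 0)"
    and g_nonzero: "(g1, g2) \<noteq> (0, 0)"
    and b_pos: "0 < b"
    and S_eq: "S = pm_semigroup f1 f2 g1 g2 b"
    and nontrivial: "\<not> (g1 \<le> 0 \<and> g2 \<le> 0)"
  shows
    "(g1 * g2 \<le> 0 \<longrightarrow>
       (\<forall>u w.
          is_monoid_generator
            {v \<in> nat_plane. lin_form g1 g2 v = 0 \<and> lin_form f1 f2 v mod b = 0} u \<longrightarrow>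
          {v \<in> level_line g1 g2 b. 0 \<le> fst v \<and> 0 \<le> snd v} \<inter> (x_axis \<union> y_axis) = {w} \<longrightarrow>
          hull_gaps {0, emb u, w, w + emb u} S \<noteq> {} \<longrightarrow>
          (\<exists>q. minimal_elements (frobenius_vectors S) = {q} \<and>
               minimal_elements
                 (closest_to (level_line g1 g2 b)
                   (hull_gaps {0, emb u, w, w + emb u} S)) = {q})))
     \<and>
     (g1 * g2 > 0 \<longrightarrow>
       (\<forall>w1 w2.
          level_line g1 g2 b \<inter> x_axis = {w1} \<longrightarrow>
          level_line g1 g2 b \<inter> y_axis = {w2} \<longrightarrow>
          finite (hull_gaps {0, w1, w2} S \<inter> nat_plane) \<and>
          frobenius_vectors S \<subseteq> hull_gaps {0, w1, w2} S \<inter> nat_plane))"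
proof (intro conjI impI allI)
  fix u w
  assume "g1 * g2 \<le> 0"
    and u: "is_monoid_generator
          {v \<in> nat_plane. lin_form g1 g2 v = 0 \<and> lin_form f1 f2 v mod b = 0} u"
    and w: "{v \<in> level_line g1 g2 b. 0 \<le> fst v \<and> 0 \<le> snd v} \<inter> (x_axis \<union> y_axis) = {w}"
    and nonempty: "hull_gaps {0, emb u, w, w + emb u} S \<noteq> {}"
  with nontrivial have signs: "0 < g1 \<and> g2 \<le> 0 \<or> g1 \<le> 0 \<and> 0 < g2"
    by (auto simp: mult_le_0_iff)
  from w have "w \<in> {v \<in> level_line g1 g2 b. 0 \<le> fst v \<and> 0 \<le> snd v} \<inter> (x_axis \<union> y_axis)"
    by blast
  then have gw: "lin_form g1 g2 w = of_int b" and w_nonneg: "0 \<le> fst w" "0 \<le> snd w"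
    and w_axis: "snd w = 0 \<or> fst w = 0"
    by (auto simp: level_line_def x_axis_def y_axis_def)
  from signs show "\<exists>q. minimal_elements (frobenius_vectors S) = {q} \<and>
      minimal_elements (closest_to (level_line g1 g2 b)
        (hull_gaps {0, emb u, w, w + emb u} S)) = {q}"
  proof
    assume s: "0 < g1 \<and> g2 \<le> 0"
    interpret opposite_signs f1 f2 g1 g2 b 0 1 S u
      using b_pos s S_eq u by unfold_locales auto
    \<comment> \<open>On the nonnegative half of the other axis \<open>g \<le> 0 < b\<close>.\<close>
    have "snd w = 0"
    proof (rule ccontr)
      assume "snd w \<noteq> 0"
      with w_axis gw have "of_int g2 * snd w = of_int b" by (simp add: lin_form_def)
      moreover have "of_int g2 * snd w \<le> 0" using s w_nonneg by (simp add: mult_nonpos_nonneg)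
      ultimately show False using b_pos by simp
    qed
    then show ?thesis
      by (intro minimal_frobenius_vector gw nonempty) (simp add: lin_form_def)
  next
    assume s: "g1 \<le> 0 \<and> 0 < g2"
    interpret opposite_signs f1 f2 g1 g2 b 1 0 S u
      using b_pos s S_eq u by unfold_locales auto
    have "fst w = 0"
    proof (rule ccontr)
      assume "fst w \<noteq> 0"
      with w_axis gw have "of_int g1 * fst w = of_int b" by (simp add: lin_form_def)
      moreover have "of_int g1 * fst w \<le> 0" using s w_nonneg by (simp add: mult_nonpos_nonneg)
      ultimately show False using b_pos by simp
    qed
    then show ?thesis
      by (intro minimal_frobenius_vector gw nonempty) (simp add: lin_form_def)
  qed
next
  fix w1 w2
  assume "g1 * g2 > 0" and w1: "level_line g1 g2 b \<inter> x_axis = {w1}"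
    and w2: "level_line g1 g2 b \<inter> y_axis = {w2}"
  with nontrivial have pos: "0 < g1" "0 < g2" by (auto simp: zero_less_mult_iff)
  have w1': "lin_form g1 g2 w1 = of_int b" "snd w1 = 0"
    using w1 by (auto simp: level_line_def x_axis_def)
  have w2': "lin_form g1 g2 w2 = of_int b" "fst w2 = 0"
    using w2 by (auto simp: level_line_def y_axis_def)
  have "lin_form g1 g2 v \<le> b" if "v \<in> hull_gaps {0, w1, w2} S" for v
    using lin_form_le_on_triangle[OF b_pos w1'(1) w2'(1), of "emb v"] that
    by (simp add: hull_gaps_def)
  then have "hull_gaps {0, w1, w2} S \<inter> nat_plane \<subseteq> {v \<in> nat_plane. lin_form g1 g2 v \<le> b}"
    by blast
  then show "finite (hull_gaps {0, w1, w2} S \<inter> nat_plane)"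
    by (rule finite_subset) (rule lattice_triangle_finite[OF pos])
  show "frobenius_vectors S \<subseteq> hull_gaps {0, w1, w2} S \<inter> nat_plane"
  proof
    fix q assume "q \<in> frobenius_vectors S"
    then have q: "q \<in> nat_plane" "q \<notin> S" by (auto simp: frobenius_vectors_def)
    then have "lin_form g1 g2 q < lin_form f1 f2 q mod b"
      by (simp add: S_eq pm_semigroup_def)
    also have "\<dots> < b" using b_pos by simp
    finally have "emb q \<in> convex hull {0, w1, w2}"
      using lattice_point_in_triangle[OF pos b_pos w1' w2' q(1)] by simp
    with q show "q \<in> hull_gaps {0, w1, w2} S \<inter> nat_plane" by (simp add: hull_gaps_def)
  qed
qed

end
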